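(* The Dynkin diagrams of the simply-laced root systems (in characteristic $0$) of Cartan type $A_n$, $D_n$ ($n\geq 4$), $E_6,E_7,E_8$ admit symplectic root systems over $\mathbb{F}_2$ of precisely the following types: - $A_{2n}$: type $(n,0)$, minimal. - $A_{2n+1}$: type $(n,1)$, minimal; and type $(n,0)$, a quotient of the minimal one. - $D_{2n+1}$: type $(n,1)$, minimal; and type $(n,0)$, a quotient of the minimal one. - $D_{2n+2}$: type $(n,2)$, minimal; type $(n,1)$, three quotients of the minimal one; and type $(n,0)$, a quotient of the minimal one. - $E_6$: type $(3,0)$, minimal. - $E_7$: type $(3,1)$, minimal; and type $(3,0)$, a quotient of the minimal one. - $E_8$: type $(4,0)$, minimal. Each symplectic root system in this list exists and is unique up to isomorphism, where for $D_{2n+2}$ there are exactly $3$ pairwise non-isomorphic quotients of type $(n,1)$.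
   Context: Graphs are finite, undirected, without loops or multiple edges; vector spaces are finite-dimensional. Here $n$ ranges over all integers for which the diagram is defined ($A_m$ for $m\ge1$, $D_m$ for $m\geq4$). A symplectic vector space over a field $\Bbbk$ is a $\Bbbk$-vector space $V$ with a (possibly degenerate) bilinear form $\langle,\rangle:V\times V\to\Bbbk$ such that $\langle v,v\rangle=0$ for all $v\in V$. Its nullspace is $V^\perp=\{v\in V\mid \langle v,w\rangle=0\ \forall w\in V\}$, and $V$ has type $(n,k)$ if $k=\dim V^\perp$ and $2n+k=\dim V$. A symplectic root system $F=(f,V)$ over $\mathbb{F}_2$ on a graph $\mathcal{G}$ consists of a symplectic vector space $V$ over $\mathbb{F}_2$ and a map $f$ from the nodes of $\mathcal{G}$ to $V$ such that the image $f(\mathcal{G})$ generates $V$, and two nodes $\alpha,\beta$ are adjacent in $\mathcal{G}$ if and only if $\langle f(\alpha),f(\beta)\rangle\neq 0$. Its type is the type of $V$. It is minimal if the family $\{f(\alpha)\}_{\alpha\in\mathcal{G}}$ is a basis of $V$. An isomorphism of symplectic root systems $(f,V)\to(g,W)$ on the same graph is a bijective linear map $\phi:V\to W$ with $\phi\circ f=g$ (the nodes of the graph are kept fixed, i.e. graph automorphisms are not used). A quotient of $(f,V)$ is a symplectic root system on the same graph of the form $(\phi\circ f,W)$ with $\phi:V\to W$ a surjective linear map such that $\langle v,w\rangle_V=\langle\phi(v),\phi(w)\rangle_W$ for all $v,w\in V$. *)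

theory Defs
  imports
    "HOL-Library.Z2"
    "HOL-Library.Function_Algebras"
    "Graph_Theory.Pair_Digraph"
begin

text \<open>
  A vector space is a subspace \<open>vecs S\<close> of an ambient type \<open>'v\<close> on which \<open>scal S\<close> is a scalar
  multiplication. The field of two elements is the type \<^typ>\<open>bit\<close>. A finite simple graph is a
  \<^const>\<open>pair_graph\<close>, that is, a finite loopless digraph whose arc relation is symmetric.
\<close>

definition linear_on ::
    "'v set \<Rightarrow> ('k::field \<Rightarrow> 'v::ab_group_add \<Rightarrow> 'v) \<Rightarrow> ('k \<Rightarrow> 'w::ab_group_add \<Rightarrow> 'w) \<Rightarrow> ('v \<Rightarrow> 'w) \<Rightarrow> bool"
  where "linear_on V s t \<phi> \<longleftrightarrow>
    (\<forall>x\<in>V. \<forall>y\<in>V. \<phi> (x + y) = \<phi> x + \<phi> y) \<and> (\<forall>c. \<forall>x\<in>V. \<phi> (s c x) = t c (\<phi> x))"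

record ('k, 'v) symp_space =
  vecs :: "'v set"
  scal :: "'k \<Rightarrow> 'v \<Rightarrow> 'v"
  form :: "'v \<Rightarrow> 'v \<Rightarrow> 'k"

locale symplectic_space = vector_space "scal S"
  for S :: "('k::field, 'v::ab_group_add, 'z) symp_space_scheme" +
  assumes subspace_vecs: "subspace (vecs S)"
    and finite_dimensional: "\<exists>B. finite B \<and> span B = vecs S"
    and form_linear_right: "v \<in> vecs S \<Longrightarrow> linear_on (vecs S) (scal S) (*) (\<lambda>w. form S v w)"
    and form_linear_left: "w \<in> vecs S \<Longrightarrow> linear_on (vecs S) (scal S) (*) (\<lambda>v. form S v w)"
    and form_alternating: "v \<in> vecs S \<Longrightarrow> form S v v = 0"

definition nullspace :: "('k::field, 'v::ab_group_add, 'z) symp_space_scheme \<Rightarrow> 'v set"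
  where "nullspace S = {v \<in> vecs S. \<forall>w\<in>vecs S. form S v w = 0}"

definition has_type :: "('k::field, 'v::ab_group_add, 'z) symp_space_scheme \<Rightarrow> nat \<Rightarrow> nat \<Rightarrow> bool"
  where "has_type S n k \<longleftrightarrow>
    k = vector_space.dim (scal S) (nullspace S) \<and> 2 * n + k = vector_space.dim (scal S) (vecs S)"

record ('a, 'v) root_sys = "(bit, 'v) symp_space" +
  root :: "'a \<Rightarrow> 'v"

locale symplectic_root_system = symplectic_space F
  for G :: "'a pair_pre_digraph" and F :: "('a, 'v::ab_group_add) root_sys" +
  assumes graph: "pair_graph G"
    and generating: "span (root F ` pverts G) = vecs F"
    and adjacent_iff: "\<lbrakk>\<alpha> \<in> pverts G; \<beta> \<in> pverts G\<rbrakk> \<Longrightarrow>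
      (\<alpha>, \<beta>) \<in> parcs G \<longleftrightarrow> form F (root F \<alpha>) (root F \<beta>) \<noteq> 0"

text \<open>
  Being a basis is a property of the family of vectors indexed by the nodes, whence the
  injectivity.
\<close>

definition minimal :: "'a pair_pre_digraph \<Rightarrow> ('a, 'v::ab_group_add) root_sys \<Rightarrow> bool"
  where "minimal G F \<longleftrightarrow> inj_on (root F) (pverts G) \<and>
    \<not> module.dependent (scal F) (root F ` pverts G) \<and>
    module.span (scal F) (root F ` pverts G) = vecs F"

text \<open>
  Preservation of the form is not required: it follows, since over the field of two elements
  adjacency determines the form on the generators.
\<close>

definition isomorphic ::
    "'a pair_pre_digraph \<Rightarrow> ('a, 'v::ab_group_add) root_sys \<Rightarrow> ('a, 'w::ab_group_add) root_sys \<Rightarrow> bool"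
  where "isomorphic G F F' \<longleftrightarrow>
    (\<exists>\<phi>. linear_on (vecs F) (scal F) (scal F') \<phi> \<and> bij_betw \<phi> (vecs F) (vecs F') \<and>
      (\<forall>\<alpha>\<in>pverts G. \<phi> (root F \<alpha>) = root F' \<alpha>))"

definition is_quotient ::
    "'a pair_pre_digraph \<Rightarrow> ('a, 'w::ab_group_add) root_sys \<Rightarrow> ('a, 'v::ab_group_add) root_sys \<Rightarrow> bool"
  where "is_quotient G Q F \<longleftrightarrow> symplectic_root_system G Q \<and>
    (\<exists>\<phi>. linear_on (vecs F) (scal F) (scal Q) \<phi> \<and> \<phi> ` vecs F = vecs Q \<and>
      (\<forall>v\<in>vecs F. \<forall>w\<in>vecs F. form F v w = form Q (\<phi> v) (\<phi> w)) \<and>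
      (\<forall>\<alpha>\<in>pverts G. root Q \<alpha> = \<phi> (root F \<alpha>)))"

text \<open>
  The list \<open>Fs\<close> contains exactly one representative of each isomorphism class of symplectic root
  systems on \<open>G\<close>. The representatives live in the infinite-dimensional space \<^typ>\<open>nat \<Rightarrow> bit\<close>; the
  systems they are compared with may live in an arbitrary type \<open>'v\<close>.
\<close>

definition represents_all ::
    "'v::ab_group_add itself \<Rightarrow> 'a pair_pre_digraph \<Rightarrow> ('a, nat \<Rightarrow> bit) root_sys list \<Rightarrow> bool"
  where "represents_all TYPE('v) G Fs \<longleftrightarrow>
    (\<forall>F\<in>set Fs. symplectic_root_system G F) \<and>
    (\<forall>i<length Fs. \<forall>j<length Fs. i \<noteq> j \<longrightarrow> \<not> isomorphic G (Fs ! i) (Fs ! j)) \<and>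
    (\<forall>F :: ('a, 'v) root_sys. symplectic_root_system G F \<longrightarrow> (\<exists>R\<in>set Fs. isomorphic G F R))"

definition undirected :: "'a set \<Rightarrow> 'a rel \<Rightarrow> 'a pair_pre_digraph"
  where "undirected V E = \<lparr>pverts = V, parcs = E \<union> E\<inverse>\<rparr>"

definition dynkin_A :: "nat \<Rightarrow> nat pair_pre_digraph"
  where "dynkin_A m = undirected {1..m} {(i, i + 1) | i. 1 \<le> i \<and> i < m}"

definition dynkin_D :: "nat \<Rightarrow> nat pair_pre_digraph"
  where "dynkin_D m = undirected {1..m} ({(i, i + 1) | i. 1 \<le> i \<and> i < m - 1} \<union> {(m - 2, m)})"

text \<open>The chain \<open>1, 3, 4, \<dots>, m\<close> with the node \<open>2\<close> attached to \<open>4\<close>.\<close>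

definition dynkin_E :: "nat \<Rightarrow> nat pair_pre_digraph"
  where "dynkin_E m = undirected {1..m} ({(1, 3), (2, 4)} \<union> {(i, i + 1) | i. 3 \<le> i \<and> i < m})"

end

theory Submission
  imports Defs
begin

text \<open>
  A symplectic root system on \<open>G\<close> is determined up to isomorphism by the linear relations between its
  roots, a subspace of the coordinate space on the nodes. Pairing a relation with each root shows
  that it lies in the kernel of the adjacency matrix modulo 2, and conversely every subspace of this
  kernel is the space of relations of a quotient of the coordinate space. So the isomorphism classes
  correspond to the subspaces of the kernel, which has dimension 0 for \<open>A\<^sub>m\<close> with even \<open>m\<close>, \<open>E\<^sub>6\<close> and
  \<open>E\<^sub>8\<close>, dimension 1 for \<open>A\<^sub>m\<close> and \<open>D\<^sub>m\<close> with odd \<open>m\<close> and for \<open>E\<^sub>7\<close>, and dimension 2 for \<open>D\<^sub>m\<close> with even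
  \<open>m\<close>; a plane over the field of two elements has five subspaces.
\<close>

section \<open>Vectors over the field of two elements\<close>

text \<open>These two rules rewrite field operations on \<^typ>\<open>bit\<close> into bit operations, out of reach of the ring lemmas.\<close>

declare add_bit_eq_xor [simp del] mult_bit_eq_and [simp del]

definition bscale :: "bit \<Rightarrow> ('a \<Rightarrow> bit) \<Rightarrow> 'a \<Rightarrow> bit"
  where "bscale c v = (\<lambda>k. c * v k)"

lemma bscale_apply [simp]: "bscale c v k = c * v k"
  by (simp add: bscale_def)

interpretation bvec: vector_space bscale
  by unfold_locales (auto simp: bscale_def fun_eq_iff algebra_simps)

lemma sum_fun_apply [simp]: "(\<Sum>k\<in>A. f k) x = (\<Sum>k\<in>A. f k x)"
  for f :: "'b \<Rightarrow> 'a \<Rightarrow> bit"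
  by (induction A rule: infinite_finite_induct) auto

lemma bit_add_eq_0_iff [simp]: "a + b = 0 \<longleftrightarrow> a = b" for a b :: bit
  by (cases a; cases b) auto

lemma bvec_add_eq_0_iff: "v + w = 0 \<longleftrightarrow> v = w" for v w :: "'a \<Rightarrow> bit"
  by (simp add: fun_eq_iff)

lemma bvec_2_eq_0 [simp]: "(2 :: 'a \<Rightarrow> bit) = 0"
proof -
  have "(2 :: 'a \<Rightarrow> bit) = 1 + 1"
    by (rule one_add_one[symmetric])
  also have "\<dots> = 0"
    unfolding bvec_add_eq_0_iff ..
  finally show ?thesis .
qed

lemma bvec_add_self [simp]: "v + v = 0" for v :: "'a \<Rightarrow> bit"
  unfolding bvec_add_eq_0_iff ..

lemma bvec_add_add_self [simp]: "v + (v + w) = w" for v w :: "'a \<Rightarrow> bit"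
  unfolding add.assoc[symmetric] bvec_add_self by simp

lemma bvec_add_self_right [simp]: "v + (w + v) = w" for v w :: "'a \<Rightarrow> bit"
  by (simp only: add.commute[of w v] bvec_add_add_self)

text \<open>The only scalars are 0 and 1, so the span of one or two vectors can be listed
  explicitly.\<close>

lemma bscale_cases: "bscale c v \<in> {0, v}"
  by (cases c) (auto simp: fun_eq_iff)

text \<open>The coordinate space on \<open>S\<close>, encoded as functions on the whole type that
  vanish off \<open>S\<close>, so that the spaces for different \<open>S\<close> are subspaces of
  one type.\<close>

definition supported :: "'a set \<Rightarrow> ('a \<Rightarrow> bit) set"
  where "supported S = {v. \<forall>k. k \<notin> S \<longrightarrow> v k = 0}"

definition unit_vec :: "'a \<Rightarrow> 'a \<Rightarrow> bit"
  where "unit_vec k = (\<lambda>l. of_bool (l = k))"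

lemma unit_vec_apply [simp]: "unit_vec k l = of_bool (l = k)"
  by (simp add: unit_vec_def)

lemma inj_unit_vec: "inj unit_vec"
  by (rule injI) (metis of_bool_eq_1_iff unit_vec_apply)

lemma subspace_supported: "bvec.subspace (supported S)"
  by (auto simp: bvec.subspace_def supported_def)

lemma unit_vec_supported: "k \<in> S \<Longrightarrow> unit_vec k \<in> supported S"
  by (auto simp: supported_def)

lemma supported_mono: "S \<subseteq> T \<Longrightarrow> supported S \<subseteq> supported T"
  by (auto simp: supported_def)

lemma supported_add: "v \<in> supported S \<Longrightarrow> w \<in> supported S \<Longrightarrow> v + w \<in> supported S"
  by (auto simp: supported_def)

lemma supported_expansion:
  assumes "finite S" "v \<in> supported S"
  shows "(\<Sum>k\<in>S. bscale (v k) (unit_vec k)) = v"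
proof
  fix x
  show "(\<Sum>k\<in>S. bscale (v k) (unit_vec k)) x = v x"
    using assms by (cases "x \<in> S") (auto simp: supported_def if_distrib of_bool_def cong: if_cong)
qed

lemma span_unit_vecs:
  assumes "finite S"
  shows "bvec.span (unit_vec ` S) = supported S"
proof
  show "bvec.span (unit_vec ` S) \<subseteq> supported S"
    by (intro bvec.span_minimal subspace_supported) (auto intro: unit_vec_supported)
  show "supported S \<subseteq> bvec.span (unit_vec ` S)"
  proof
    fix v assume "v \<in> supported S"
    have "(\<Sum>k\<in>S. bscale (v k) (unit_vec k)) \<in> bvec.span (unit_vec ` S)"
      by (intro bvec.span_sum bvec.span_scale bvec.span_base) auto
    then show "v \<in> bvec.span (unit_vec ` S)"
      using supported_expansion[OF assms \<open>v \<in> supported S\<close>] by simp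
  qed
qed

text \<open>A unit vector at a new position is 1 there, whereas everything in the span of the
  earlier ones vanishes there.\<close>

lemma independent_unit_vecs:
  assumes "finite S"
  shows "\<not> bvec.dependent (unit_vec ` S)"
  using assms
proof (induction S)
  case (insert k S)
  then have "unit_vec k \<notin> bvec.span (unit_vec ` S)"
    by (auto simp: span_unit_vecs supported_def)
  then show ?case
    using insert.IH unfolding image_insert by (rule bvec.independent_insertI)
next
  case empty
  show ?case
    unfolding image_empty by (rule bvec.independent_empty)
qed

lemma dim_supported:
  assumes "finite S"
  shows "bvec.dim (supported S) = card S"
proof -
  have "bvec.dim (supported S) = card (unit_vec ` S)"
    using bvec.dim_span_eq_card_independent[OF independent_unit_vecs[OF assms]]
    by (simp add: span_unit_vecs assms)
  also have "\<dots> = card S"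
    by (rule card_image) (use inj_unit_vec in \<open>auto intro: inj_on_subset\<close>)
  finally show ?thesis .
qed

section \<open>Lines and planes over the field of two elements\<close>

lemma dim_zero: "bvec.dim {0} = 0"
  by (metis bvec.dim_span_eq_card_independent bvec.independent_empty bvec.span_empty card.empty)

lemma span_singleton: "bvec.span {a} = {0, a}"
  using bscale_cases[of _ a] by (auto simp: bvec.span_singleton intro: range_eqI[of _ _ 0] range_eqI[of _ _ 1])

lemma dim_line:
  assumes "a \<noteq> 0"
  shows "bvec.dim {0, a} = 1"
  using bvec.dim_span_eq_card_independent[of "{a}"] assms by (simp add: span_singleton)

lemma span_pair: "bvec.span {a, b} = {0, a, b, a + b}"
proof
  have "bvec.subspace {0, a, b, a + b}"
    unfolding bvec.subspace_def
  proof (intro conjI ballI allI)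
    fix x c assume "x \<in> {0, a, b, a + b}"
    then show "bscale c x \<in> {0, a, b, a + b}"
      using bscale_cases[of c x] by auto
  qed (auto simp: ac_simps)
  then show "bvec.span {a, b} \<subseteq> {0, a, b, a + b}"
    by (intro bvec.span_minimal) auto
  show "{0, a, b, a + b} \<subseteq> bvec.span {a, b}"
    by (auto intro: bvec.span_zero bvec.span_base bvec.span_add)
qed

text \<open>Distinct nonzero vectors are independent here, since the span of \<open>b\<close>
  contains only 0 and \<open>b\<close>.\<close>

lemma dim_plane:
  assumes "a \<noteq> 0" "b \<noteq> 0" "a \<noteq> b"
  shows "bvec.dim {0, a, b, a + b} = 2"
proof -
  have "\<not> bvec.dependent {a, b}"
    using assms by (intro bvec.independent_insertI) (auto simp: span_singleton bvec.independent_empty)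
  then show ?thesis
    using bvec.dim_span_eq_card_independent[of "{a, b}"] assms by (simp add: span_pair)
qed

section \<open>The null vectors of a graph\<close>

text \<open>The bilinear form whose Gram matrix on the unit vectors of the nodes is the adjacency
  matrix modulo 2.\<close>

definition graph_form :: "'a pair_pre_digraph \<Rightarrow> ('a \<Rightarrow> bit) \<Rightarrow> ('a \<Rightarrow> bit) \<Rightarrow> bit"
  where "graph_form G v w =
    (\<Sum>k\<in>pverts G. \<Sum>l\<in>pverts G. of_bool ((k, l) \<in> parcs G) * (v k * w l))"

text \<open>The kernel of the adjacency matrix modulo 2; \<open>graph_form_null\<close> identifies
  it with the radical of \<open>graph_form\<close> on the coordinate space of a graph.\<close>

definition null_vectors :: "'a pair_pre_digraph \<Rightarrow> ('a \<Rightarrow> bit) set"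
  where "null_vectors G =
    {v \<in> supported (pverts G). \<forall>l\<in>pverts G. (\<Sum>k | (k, l) \<in> parcs G. v k) = 0}"

lemma graph_form_add_left: "graph_form G (v + v') w = graph_form G v w + graph_form G v' w"
  by (simp add: graph_form_def algebra_simps sum.distrib)

lemma graph_form_add_right: "graph_form G v (w + w') = graph_form G v w + graph_form G v w'"
  by (simp add: graph_form_def algebra_simps sum.distrib)

lemma graph_form_scale_left: "graph_form G (bscale c v) w = c * graph_form G v w"
  by (simp add: graph_form_def sum_distrib_left ac_simps)

lemma graph_form_scale_right: "graph_form G v (bscale c w) = c * graph_form G v w"
  by (simp add: graph_form_def sum_distrib_left ac_simps)

text \<open>The diagonal contributes nothing and the off-diagonal terms cancel in pairs, because 1 +
  1 = 0: each new index adds a row and a column with equal sums.\<close>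

lemma sum_symmetric_hollow:
  fixes f :: "'a \<Rightarrow> 'a \<Rightarrow> bit"
  assumes "finite A" "\<And>k. f k k = 0" "\<And>k l. f k l = f l k"
  shows "(\<Sum>k\<in>A. \<Sum>l\<in>A. f k l) = 0"
  using assms(1)
proof (induction A)
  case (insert a A)
  have "(\<Sum>k\<in>A. f k a) = (\<Sum>l\<in>A. f a l)"
    using assms(3) by simp
  then show ?case
    using insert by (simp add: sum.distrib assms(2))
qed simp

context pair_graph
begin

lemma arc_sym: "(k, l) \<in> parcs G \<longleftrightarrow> (l, k) \<in> parcs G"
  by (metis arcs_symmetric)

lemma graph_form_self: "graph_form G v v = 0"
  unfolding graph_form_def
  by (rule sum_symmetric_hollow) (use arc_sym no_loops' in \<open>auto simp: mult.commute\<close>)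

lemma graph_form_unit_right:
  assumes "l \<in> pverts G"
  shows "graph_form G v (unit_vec l) = (\<Sum>k | (k, l) \<in> parcs G. v k)"
proof -
  have "graph_form G v (unit_vec l) =
      (\<Sum>k\<in>pverts G. \<Sum>j\<in>pverts G. if j = l then of_bool ((k, l) \<in> parcs G) * v k else 0)"
    unfolding graph_form_def by (intro sum.cong refl) auto
  also have "\<dots> = (\<Sum>k\<in>pverts G. of_bool ((k, l) \<in> parcs G) * v k)"
    using assms by simp
  also have "\<dots> = (\<Sum>k | (k, l) \<in> parcs G. v k)"
    by (rule sum.mono_neutral_cong_right) (auto dest: in_arcsD1)
  finally show ?thesis .
qed

end

text \<open>It suffices to test against unit vectors, where the form gives the neighbour sums of
  \<open>v\<close>; a general \<open>w\<close> gives a combination of these sums with coefficients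
  \<open>w l\<close>.\<close>

lemma (in pair_graph) graph_form_null:
  assumes "v \<in> supported (pverts G)"
  shows "v \<in> null_vectors G \<longleftrightarrow> (\<forall>w\<in>supported (pverts G). graph_form G v w = 0)"
proof
  assume v: "v \<in> null_vectors G"
  show "\<forall>w\<in>supported (pverts G). graph_form G v w = 0"
  proof
    fix w assume w: "w \<in> supported (pverts G)"
    have "graph_form G v w = (\<Sum>l\<in>pverts G. \<Sum>k\<in>pverts G. of_bool ((k, l) \<in> parcs G) * (v k * w l))"
      unfolding graph_form_def by (rule sum.swap)
    also have "\<dots> = (\<Sum>l\<in>pverts G. w l * graph_form G v (unit_vec l))"
    proof (intro sum.cong refl)
      fix l assume "l \<in> pverts G"
      have "(\<Sum>k\<in>pverts G. of_bool ((k, l) \<in> parcs G) * (v k * w l)) = (\<Sum>k | (k, l) \<in> parcs G. v k * w l)"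
        by (rule sum.mono_neutral_cong_right) (auto dest: in_arcsD1)
      then show "(\<Sum>k\<in>pverts G. of_bool ((k, l) \<in> parcs G) * (v k * w l)) =
          w l * graph_form G v (unit_vec l)"
        using \<open>l \<in> pverts G\<close> by (simp add: graph_form_unit_right sum_distrib_left mult.commute)
    qed
    also have "\<dots> = 0"
      using v by (intro sum.neutral) (simp add: graph_form_unit_right null_vectors_def)
    finally show "graph_form G v w = 0" .
  qed
next
  assume "\<forall>w\<in>supported (pverts G). graph_form G v w = 0"
  then have "graph_form G v (unit_vec l) = 0" if "l \<in> pverts G" for l
    using that by (simp add: unit_vec_supported)
  then show "v \<in> null_vectors G"
    using assms by (simp add: null_vectors_def graph_form_unit_right)
qed

text \<open>Polarisation: expanding the form at \<open>v + w\<close> leaves only the two mixed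
  terms, and in characteristic 2 a vanishing sum means that they are equal.\<close>

lemma (in pair_graph) graph_form_commute: "graph_form G v w = graph_form G w v"
proof -
  have "graph_form G (v + w) (v + w) = 0"
    by (rule graph_form_self)
  then show ?thesis
    by (simp add: graph_form_add_left graph_form_add_right graph_form_self)
qed

lemma null_vectors_supported: "v \<in> null_vectors G \<Longrightarrow> v \<in> supported (pverts G)"
  by (simp add: null_vectors_def)

lemma subspace_null_vectors: "bvec.subspace (null_vectors G)"
  using subspace_supported[of "pverts G"]
  by (auto simp: bvec.subspace_def null_vectors_def sum.distrib simp flip: sum_distrib_left)

section \<open>Relations between the roots\<close>

text \<open>The linear map from the coordinate space on the nodes that sends each unit vector to the
  corresponding root.\<close>

definition combination :: "'a pair_pre_digraph \<Rightarrow> ('a, 'v::ab_group_add) root_sys \<Rightarrow> ('a \<Rightarrow> bit) \<Rightarrow> 'v"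
  where "combination G F c = (\<Sum>k\<in>pverts G. scal F (c k) (root F k))"

text \<open>The kernel of \<open>combination\<close>, which ignores coefficients off the nodes; the
  support condition fixes these to 0.\<close>

definition relations :: "'a pair_pre_digraph \<Rightarrow> ('a, 'v::ab_group_add) root_sys \<Rightarrow> ('a \<Rightarrow> bit) set"
  where "relations G F = {c \<in> supported (pverts G). combination G F c = 0}"

context symplectic_root_system
begin

sublocale pair_graph G
  by (rule graph)

lemma combination_add: "combination G F (c + d) = combination G F c + combination G F d"
  by (simp add: combination_def scale_left_distrib sum.distrib)

lemma combination_scale: "combination G F (bscale a c) = scal F a (combination G F c)"
  by (simp add: combination_def scale_sum_right)

lemma root_in_vecs: "k \<in> pverts G \<Longrightarrow> root F k \<in> vecs F"
  using generating span_base by blast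

lemma combination_unit_vec:
  assumes "l \<in> pverts G"
  shows "combination G F (unit_vec l) = root F l"
proof -
  have "combination G F (unit_vec l) = (\<Sum>k\<in>pverts G. if k = l then root F l else 0)"
    unfolding combination_def by (intro sum.cong refl) simp
  then show ?thesis
    using assms by simp
qed

text \<open>The image is a subspace that contains every root, and the roots generate
  \<open>vecs F\<close>.\<close>

lemma combination_image: "combination G F ` supported (pverts G) = vecs F"
proof
  show "combination G F ` supported (pverts G) \<subseteq> vecs F"
    unfolding combination_def
    by (auto intro!: subspace_sum subspace_vecs subspace_scale root_in_vecs)
  have "subspace (combination G F ` supported (pverts G))"
    unfolding subspace_def
  proof (intro conjI ballI allI)
    have "combination G F 0 = 0"
      by (simp add: combination_def)
    moreover have "0 \<in> supported (pverts G)"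
      by (simp add: supported_def)
    ultimately show "0 \<in> combination G F ` supported (pverts G)"
      by (metis image_eqI)
  next
    fix x y assume "x \<in> combination G F ` supported (pverts G)" "y \<in> combination G F ` supported (pverts G)"
    then show "x + y \<in> combination G F ` supported (pverts G)"
      by (auto intro!: imageI supported_add simp flip: combination_add)
  next
    fix a x assume "x \<in> combination G F ` supported (pverts G)"
    then show "scal F a x \<in> combination G F ` supported (pverts G)"
      by (auto intro!: imageI bvec.subspace_scale[OF subspace_supported] simp flip: combination_scale)
  qed
  moreover have "root F ` pverts G \<subseteq> combination G F ` supported (pverts G)"
  proof clarify
    fix k assume "k \<in> pverts G"
    then show "root F k \<in> combination G F ` supported (pverts G)"
      using imageI[OF unit_vec_supported, of k "pverts G" "combination G F"]
      by (simp add: combination_unit_vec)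
  qed
  ultimately show "vecs F \<subseteq> combination G F ` supported (pverts G)"
    using span_minimal generating by blast
qed

text \<open>A nonzero scalar must be 1, so adjacency fixes the value of the form on roots and not
  only whether it vanishes.\<close>

lemma form_root_root:
  assumes "k \<in> pverts G" "l \<in> pverts G"
  shows "form F (root F k) (root F l) = of_bool ((k, l) \<in> parcs G)"
  using adjacent_iff[OF assms] by simp

lemma form_sum_left:
  assumes "finite A" "\<And>k. k \<in> A \<Longrightarrow> x k \<in> vecs F" "w \<in> vecs F"
  shows "form F (\<Sum>k\<in>A. scal F (c k) (x k)) w = (\<Sum>k\<in>A. c k * form F (x k) w)"
  using assms(1,2)
proof (induction A)
  case empty
  \<comment> \<open>Linearity is stated as additivity and homogeneity, so vanishing at 0 is read off
    from the scalar 0.\<close>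
  have "form F (scal F 0 0) w = 0 * form F 0 w"
    using form_linear_left[OF assms(3)] subspace_0[OF subspace_vecs] unfolding linear_on_def by blast
  then show ?case
    by simp
next
  case (insert a A)
  have "(\<Sum>k\<in>A. scal F (c k) (x k)) \<in> vecs F"
    using insert by (auto intro!: subspace_sum subspace_vecs subspace_scale)
  moreover have "scal F (c a) (x a) \<in> vecs F"
    using insert by (auto intro!: subspace_vecs subspace_scale)
  ultimately show ?case
    using insert form_linear_left[OF assms(3)] by (simp add: linear_on_def)
qed

text \<open>Pair a relation \<open>c\<close> with the root at \<open>l\<close>: the result is 0
  because the combination is 0, and by linearity it is the sum of \<open>c\<close> over the
  neighbours of \<open>l\<close>.\<close>

lemma relations_null: "relations G F \<subseteq> null_vectors G"
proof
  fix c assume c: "c \<in> relations G F"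
  have "(\<Sum>k | (k, l) \<in> parcs G. c k) = 0" if l: "l \<in> pverts G" for l
  proof -
    have "form F (combination G F c) (root F l) = (\<Sum>k\<in>pverts G. c k * form F (root F k) (root F l))"
      unfolding combination_def
      by (rule form_sum_left) (use l root_in_vecs in auto)
    also have "\<dots> = (\<Sum>k | (k, l) \<in> parcs G. c k)"
    proof (rule sum.mono_neutral_cong_right)
      show "\<forall>k\<in>pverts G - {k. (k, l) \<in> parcs G}. c k * form F (root F k) (root F l) = 0"
        using l by (auto simp: form_root_root)
      show "c k * form F (root F k) (root F l) = c k" if "k \<in> {k. (k, l) \<in> parcs G}" for k
        using that l in_arcsD1[of k l] by (simp add: form_root_root)
    qed (auto dest: in_arcsD1)
    finally have "form F (combination G F c) (root F l) = (\<Sum>k | (k, l) \<in> parcs G. c k)" .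
    moreover have "form F (combination G F c) (root F l) = 0"
    proof -
      have "form F (scal F 0 0) (root F l) = 0 * form F 0 (root F l)"
        using form_linear_left[OF root_in_vecs[OF l]] subspace_0[OF subspace_vecs]
        unfolding linear_on_def by blast
      then show ?thesis
        using c by (simp add: relations_def)
    qed
    ultimately show ?thesis
      by simp
  qed
  then show "c \<in> null_vectors G"
    using c by (simp add: null_vectors_def relations_def)
qed

lemma subspace_relations: "bvec.subspace (relations G F)"
  using subspace_supported[of "pverts G"]
  by (auto simp: bvec.subspace_def relations_def combination_add combination_scale)
    (simp add: combination_def)

end

text \<open>A system is the coordinate space modulo its relations. An isomorphism fixing the nodes
  commutes with \<open>combination\<close> and so preserves its kernel; conversely, equal kernels
  let one combination be sent to the other with the same coefficients.\<close>

lemma isomorphic_iff_relations: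
  assumes "symplectic_root_system G F" "symplectic_root_system G F'"
  shows "isomorphic G F F' \<longleftrightarrow> relations G F = relations G F'"
proof
  interpret F: symplectic_root_system G F by fact
  interpret F': symplectic_root_system G F' by fact
  let ?S = "supported (pverts G)"
  {
    assume "isomorphic G F F'"
    then obtain \<phi> where \<phi>: "linear_on (vecs F) (scal F) (scal F') \<phi>"
      "bij_betw \<phi> (vecs F) (vecs F')" "\<forall>k\<in>pverts G. \<phi> (root F k) = root F' k"
      unfolding isomorphic_def by blast
    have zero: "\<phi> 0 = 0"
    proof -
      have "\<phi> (scal F 0 0) = scal F' 0 (\<phi> 0)"
        using \<phi>(1) F.subspace_0[OF F.subspace_vecs] unfolding linear_on_def by blast
      then show ?thesis
        by simp
    qed
    have "\<phi> (\<Sum>k\<in>A. scal F (c k) (root F k)) = (\<Sum>k\<in>A. scal F' (c k) (root F' k))"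
      if "finite A" "A \<subseteq> pverts G" for A c
      using that
    proof (induction A)
      case empty
      then show ?case
        by (simp add: zero)
    next
      case (insert a A)
      have "(\<Sum>k\<in>A. scal F (c k) (root F k)) \<in> vecs F"
        using insert
        by (auto intro!: F.subspace_sum F.subspace_vecs F.subspace_scale F.root_in_vecs)
      moreover have "scal F (c a) (root F a) \<in> vecs F" "root F a \<in> vecs F"
        using insert by (auto intro!: F.subspace_vecs F.subspace_scale F.root_in_vecs)
      ultimately show ?case
        using insert \<phi>(1,3) by (simp add: linear_on_def)
    qed
    then have comb: "\<phi> (combination G F c) = combination G F' c" for c
      by (simp add: combination_def)
    have "combination G F c = 0 \<longleftrightarrow> combination G F' c = 0" if "c \<in> ?S" for c
      using that comb zero \<phi>(2) F.combination_image F.subspace_0[OF F.subspace_vecs]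
      by (metis bij_betw_def image_eqI inj_onD)
    then show "relations G F = relations G F'"
      by (auto simp: relations_def)
  }
  assume rel: "relations G F = relations G F'"
  \<comment> \<open>Two combinations agree exactly when the difference of their coefficients is a
    relation, and the relations are common to both systems.\<close>
  have eq: "combination G F c = combination G F d \<longleftrightarrow> combination G F' c = combination G F' d"
    if "c \<in> ?S" "d \<in> ?S" for c d
  proof -
    have "combination G F c = combination G F d \<longleftrightarrow> c - d \<in> relations G F"
      using that bvec.subspace_diff[OF subspace_supported that] F.combination_add[of "c - d" d]
      by (auto simp: relations_def)
    moreover have "combination G F' c = combination G F' d \<longleftrightarrow> c - d \<in> relations G F'"
      using that bvec.subspace_diff[OF subspace_supported that] F'.combination_add[of "c - d" d]
      by (auto simp: relations_def)
    ultimately show ?thesis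
      using rel by simp
  qed
  \<comment> \<open>Any coefficients representing \<open>x\<close> may be chosen; by
    \<open>eq\<close> the value does not depend on the choice.\<close>
  define \<phi> where "\<phi> x = combination G F' (SOME c. c \<in> ?S \<and> combination G F c = x)" for x
  have \<phi>: "\<phi> (combination G F c) = combination G F' c" if "c \<in> ?S" for c
  proof -
    have "\<exists>d. d \<in> ?S \<and> combination G F d = combination G F c"
      using that by blast
    from someI_ex[OF this] show ?thesis
      unfolding \<phi>_def using eq that by metis
  qed
  show "isomorphic G F F'"
    unfolding isomorphic_def
  proof (intro exI[of _ \<phi>] conjI ballI)
    show "linear_on (vecs F) (scal F) (scal F') \<phi>"
      unfolding linear_on_def F.combination_image[symmetric]
      by (auto simp: \<phi> supported_add bvec.subspace_scale[OF subspace_supported]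
          F'.combination_add F'.combination_scale
          simp flip: F.combination_add F.combination_scale)
    have "inj_on \<phi> (vecs F)"
      unfolding F.combination_image[symmetric] by (auto intro!: inj_onI simp: \<phi> eq)
    moreover have "\<phi> ` vecs F = vecs F'"
      unfolding F.combination_image[symmetric] F'.combination_image[symmetric]
      by (auto simp: \<phi> image_image)
    ultimately show "bij_betw \<phi> (vecs F) (vecs F')"
      by (simp add: bij_betw_def)
    show "\<phi> (root F k) = root F' k" if "k \<in> pverts G" for k
      using \<phi>[OF unit_vec_supported[OF that]] that
      by (simp add: F.combination_unit_vec F'.combination_unit_vec)
  qed
qed

text \<open>Since relation spaces classify systems and always are subspaces of the kernel, a list of
  systems is complete and irredundant once its relation spaces are distinct and exhaust those
  subspaces.\<close>

lemma represents_allI: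
  fixes Fs :: "('a, nat \<Rightarrow> bit) root_sys list"
  assumes systems: "\<And>F. F \<in> set Fs \<Longrightarrow> symplectic_root_system G F"
    and distinct: "distinct (map (relations G) Fs)"
    and exhaustive: "\<And>K. bvec.subspace K \<Longrightarrow> K \<subseteq> null_vectors G \<Longrightarrow> K \<in> relations G ` set Fs"
  shows "represents_all TYPE('v::ab_group_add) G Fs"
  unfolding represents_all_def
proof (intro conjI ballI allI impI)
  show "\<not> isomorphic G (Fs ! i) (Fs ! j)" if "i < length Fs" "j < length Fs" "i \<noteq> j" for i j
    using that nth_eq_iff_index_eq[OF distinct, of i j] by (simp add: isomorphic_iff_relations systems)
  show "\<exists>R\<in>set Fs. isomorphic G F R" if "symplectic_root_system G F" for F :: "('a, 'v) root_sys"
  proof -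
    have "relations G F \<in> relations G ` set Fs"
      using that by (intro exhaustive symplectic_root_system.subspace_relations
          symplectic_root_system.relations_null)
    then obtain R where "R \<in> set Fs" "relations G F = relations G R"
      by blast
    then show ?thesis
      using that isomorphic_iff_relations systems by blast
  qed
qed (rule systems)

section \<open>Quotients of the minimal system\<close>

text \<open>One step of Gaussian elimination at all pivots at once: \<open>u i\<close> is subtracted
  with the coefficient \<open>v i\<close>, subtraction being addition in characteristic 2.\<close>

definition reduction :: "'a set \<Rightarrow> ('a \<Rightarrow> 'a \<Rightarrow> bit) \<Rightarrow> ('a \<Rightarrow> bit) \<Rightarrow> 'a \<Rightarrow> bit"
  where "reduction I u v = v + (\<Sum>i\<in>I. bscale (v i) (u i))"

text \<open>
  For \<open>I = {}\<close> this is the minimal system. In general it is the quotient by the span of the null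
  vectors \<open>u i\<close> in reduced echelon form with pivots \<open>I\<close>, realised on the complement of the span
  consisting of the vectors that vanish at the pivots.
\<close>

definition reduced_sys ::
    "'a pair_pre_digraph \<Rightarrow> 'a set \<Rightarrow> ('a \<Rightarrow> 'a \<Rightarrow> bit) \<Rightarrow> ('a, 'a \<Rightarrow> bit) root_sys"
  where "reduced_sys G I u = \<lparr>vecs = supported (pverts G - I), scal = bscale,
    form = graph_form G, root = (\<lambda>k. reduction I u (unit_vec k))\<rparr>"

lemma reduced_sys_simps [simp]:
  "vecs (reduced_sys G I u) = supported (pverts G - I)"
  "scal (reduced_sys G I u) = bscale"
  "form (reduced_sys G I u) = graph_form G"
  "root (reduced_sys G I u) k = reduction I u (unit_vec k)"
  by (simp_all add: reduced_sys_def)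

lemma reduction_add: "reduction I u (v + w) = reduction I u v + reduction I u w"
  by (simp add: reduction_def bvec.scale_left_distrib sum.distrib ac_simps)

lemma reduction_scale: "reduction I u (bscale c v) = bscale c (reduction I u v)"
  by (simp add: reduction_def bvec.scale_right_distrib bvec.scale_sum_right)

lemma reduction_sum: "reduction I u (\<Sum>k\<in>A. bscale (c k) (f k)) = (\<Sum>k\<in>A. bscale (c k) (reduction I u (f k)))"
proof (induction A rule: infinite_finite_induct)
  case (insert a A)
  show ?case
    unfolding sum.insert[OF insert.hyps] reduction_add reduction_scale insert.IH ..
qed (simp_all add: reduction_def)

lemma reduction_empty [simp]: "reduction {} u v = v"
  by (simp add: reduction_def)

text \<open>Condition \<open>reduced\<close> makes \<open>reduction\<close> a projection onto the
  vectors vanishing at the pivots, and condition \<open>null\<close> makes it preserve the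
  form.\<close>

locale reduced_family = pair_graph G for G :: "'a pair_pre_digraph" +
  fixes I :: "'a set" and u :: "'a \<Rightarrow> 'a \<Rightarrow> bit"
  assumes pivots: "I \<subseteq> pverts G"
    and null: "i \<in> I \<Longrightarrow> u i \<in> null_vectors G"
    and reduced: "i \<in> I \<Longrightarrow> j \<in> I \<Longrightarrow> u i j = of_bool (i = j)"
begin

abbreviation "R \<equiv> reduced_sys G I u"

lemma finite_pivots: "finite I"
  using pivots pair_finite_verts by (rule finite_subset)

lemma reduction_diff_null: "(\<Sum>i\<in>I. bscale (v i) (u i)) \<in> null_vectors G"
  by (intro bvec.subspace_sum bvec.subspace_scale subspace_null_vectors null)

lemma reduction_supported:
  assumes "v \<in> supported (pverts G)"
  shows "reduction I u v \<in> supported (pverts G - I)"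
proof -
  have "reduction I u v \<in> supported (pverts G)"
    unfolding reduction_def
    by (intro supported_add assms null_vectors_supported reduction_diff_null)
  \<comment> \<open>At a pivot \<open>j\<close> only \<open>u j\<close> contributes, with value
    \<open>v j\<close>, which cancels the entry of \<open>v\<close>.\<close>
  moreover have "reduction I u v j = 0" if "j \<in> I" for j
  proof -
    have "(\<Sum>i\<in>I. v i * u i j) = (\<Sum>i\<in>I. if i = j then v j else 0)"
      using that reduced by (intro sum.cong refl) simp
    then show ?thesis
      using that finite_pivots by (simp add: reduction_def)
  qed
  ultimately show ?thesis
    by (auto simp: supported_def)
qed

lemma reduction_id:
  assumes "v \<in> supported (pverts G - I)"
  shows "reduction I u v = v"
proof -
  have "(\<Sum>i\<in>I. bscale (v i) (u i)) = 0"
    using assms by (intro sum.neutral) (auto simp: supported_def)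
  then show ?thesis
    by (simp add: reduction_def)
qed

lemma reduction_image: "reduction I u ` supported (pverts G) = supported (pverts G - I)"
proof
  show "reduction I u ` supported (pverts G) \<subseteq> supported (pverts G - I)"
    using reduction_supported by blast
  show "supported (pverts G - I) \<subseteq> reduction I u ` supported (pverts G)"
  proof
    fix v assume v: "v \<in> supported (pverts G - I)"
    then have "v \<in> supported (pverts G)"
      using supported_mono[of "pverts G - I" "pverts G"] by auto
    then show "v \<in> reduction I u ` supported (pverts G)"
      using reduction_id[OF v] by (metis image_eqI)
  qed
qed

text \<open>Reduction changes \<open>v\<close> by a null vector, and null vectors are orthogonal to
  the coordinate space.\<close>

lemma graph_form_reduction_left:
  assumes "w \<in> supported (pverts G)"
  shows "graph_form G (reduction I u v) w = graph_form G v w"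
proof -
  have "graph_form G (\<Sum>i\<in>I. bscale (v i) (u i)) w = 0"
    using reduction_diff_null[of v] assms graph_form_null[OF null_vectors_supported] by blast
  then show ?thesis
    by (simp only: reduction_def graph_form_add_left add_0_right)
qed

lemma graph_form_reduction:
  assumes "v \<in> supported (pverts G)" "w \<in> supported (pverts G)"
  shows "graph_form G (reduction I u v) (reduction I u w) = graph_form G v w"
proof -
  have "reduction I u w \<in> supported (pverts G)"
    using reduction_supported[OF assms(2)] supported_mono[of "pverts G - I" "pverts G"] by blast
  then show ?thesis
    using assms by (metis graph_form_commute graph_form_reduction_left)
qed

lemma combination_reduced_sys:
  assumes "c \<in> supported (pverts G)"
  shows "combination G R c = reduction I u c"
  using supported_expansion[OF pair_finite_verts assms]
  by (simp add: combination_def flip: reduction_sum)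

text \<open>The relations form the kernel of \<open>reduction\<close>. A vector in it equals the
  combination of the \<open>u i\<close> added to it, and each \<open>u i\<close> reduces to 0
  because it is 1 at its own pivot and 0 at the others.\<close>

lemma relations_reduced_sys: "relations G R = bvec.span (u ` I)"
proof
  show "relations G R \<subseteq> bvec.span (u ` I)"
  proof
    fix c assume c: "c \<in> relations G R"
    then have "c = (\<Sum>i\<in>I. bscale (c i) (u i))"
      by (auto simp: relations_def combination_reduced_sys bvec_add_eq_0_iff reduction_def)
    also have "\<dots> \<in> bvec.span (u ` I)"
      by (intro bvec.span_sum bvec.span_scale bvec.span_base) auto
    finally show "c \<in> bvec.span (u ` I)" .
  qed
  have "reduction I u (u i) = 0" if "i \<in> I" for i
  proof -
    have "(\<Sum>j\<in>I. bscale (u i j) (u j)) = (\<Sum>j\<in>I. if j = i then u i else 0)"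
      using that by (intro sum.cong refl) (auto simp: reduced)
    then show ?thesis
      using that finite_pivots by (simp add: reduction_def)
  qed
  moreover have "bvec.subspace (relations G R)"
  proof -
    have eq: "relations G R = {c \<in> supported (pverts G). reduction I u c = 0}"
      by (auto simp: relations_def combination_reduced_sys)
    have "reduction I u 0 = 0"
      by (simp add: reduction_def)
    then show ?thesis
      unfolding eq using subspace_supported[of "pverts G"]
      by (simp add: bvec.subspace_def reduction_add reduction_scale)
  qed
  ultimately show "bvec.span (u ` I) \<subseteq> relations G R"
    by (intro bvec.span_minimal)
      (auto simp: relations_def combination_reduced_sys null null_vectors_supported)
qed

lemma symplectic_root_system_reduced_sys: "symplectic_root_system G R"
proof -
  have V: "vector_space (scal R)"
    by (simp add: bvec.vector_space_axioms)
  have span: "bvec.span (root R ` pverts G) = vecs R"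
  proof
    show "bvec.span (root R ` pverts G) \<subseteq> vecs R"
      by (intro bvec.span_minimal) (auto simp: subspace_supported reduction_supported unit_vec_supported)
    show "vecs R \<subseteq> bvec.span (root R ` pverts G)"
    proof
      fix v assume "v \<in> vecs R"
      then have v: "v \<in> supported (pverts G - I)" "v \<in> supported (pverts G)"
        using supported_mono[of "pverts G - I" "pverts G"] by auto
      have "combination G R v \<in> bvec.span (root R ` pverts G)"
        unfolding combination_def reduced_sys_simps
        by (intro bvec.span_sum bvec.span_scale bvec.span_base) auto
      then show "v \<in> bvec.span (root R ` pverts G)"
        using v by (simp add: combination_reduced_sys reduction_id)
    qed
  qed
  have "symplectic_space R"
    using V
  proof (rule symplectic_space.intro, unfold_locales, goal_cases)
    case 1
    show ?case
      using subspace_supported by simp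
  next
    case 2
    have "finite (unit_vec ` (pverts G - I))" "bvec.span (unit_vec ` (pverts G - I)) = vecs R"
      using pair_finite_verts by (simp_all add: span_unit_vecs)
    then show ?case
      unfolding reduced_sys_simps by blast
  next
    case (3 v)
    show ?case
      by (simp add: linear_on_def graph_form_add_right graph_form_scale_right)
  next
    case (4 w)
    show ?case
      by (simp add: linear_on_def graph_form_add_left graph_form_scale_left)
  next
    case (5 v)
    show ?case
      by (simp add: graph_form_self)
  qed
  moreover have "symplectic_root_system_axioms G R"
  proof (rule symplectic_root_system_axioms.intro)
    show "pair_graph G"
      by (rule pair_graph_axioms)
    show "module.span (scal R) (root R ` pverts G) = vecs R"
      using span by simp
    fix k l assume kl: "k \<in> pverts G" "l \<in> pverts G"
    \<comment> \<open>Reduction preserves the form, so the roots pair as the unit vectors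
      do.\<close>
    have "form R (root R k) (root R l) = (\<Sum>j | (j, l) \<in> parcs G. if j = k then 1 else 0)"
      using kl by (simp add: graph_form_reduction unit_vec_supported graph_form_unit_right of_bool_def)
    moreover have "finite {j. (j, l) \<in> parcs G}"
      by (rule finite_subset[OF _ pair_finite_verts]) (auto dest: in_arcsD1)
    ultimately show "(k, l) \<in> parcs G \<longleftrightarrow> form R (root R k) (root R l) \<noteq> 0"
      by simp
  qed
  ultimately show ?thesis
    by (rule symplectic_root_system.intro)
qed

text \<open>Reduction maps the coordinate space onto \<open>vecs R\<close> and preserves the form,
  so orthogonality to \<open>vecs R\<close> already implies orthogonality to the whole coordinate
  space.\<close>

lemma nullspace_reduced_sys: "nullspace R = null_vectors G \<inter> supported (pverts G - I)"
proof -
  have "v \<in> null_vectors G \<longleftrightarrow> (\<forall>w\<in>supported (pverts G - I). graph_form G v w = 0)"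
    if v: "v \<in> supported (pverts G - I)" for v
  proof -
    have "v \<in> supported (pverts G)"
      using v supported_mono[of "pverts G - I" "pverts G"] by auto
    then have "v \<in> null_vectors G \<longleftrightarrow>
        (\<forall>w\<in>supported (pverts G). graph_form G (reduction I u v) (reduction I u w) = 0)"
      by (simp add: graph_form_null graph_form_reduction)
    also have "\<dots> \<longleftrightarrow> (\<forall>w\<in>supported (pverts G - I). graph_form G v w = 0)"
      unfolding reduction_image[symmetric] using v by (simp add: reduction_id)
    finally show ?thesis .
  qed
  then show ?thesis
    by (auto simp: nullspace_def)
qed

text \<open>The space has dimension \<open>card (pverts G) - card I\<close>; the dimension count is
  stated additively to avoid natural subtraction.\<close>

lemma has_type_reduced_sys:
  assumes "bvec.dim (null_vectors G \<inter> supported (pverts G - I)) = k" "2 * n + k + card I = card (pverts G)"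
  shows "has_type R n k"
  unfolding has_type_def nullspace_reduced_sys
  using assms card_mono[OF pair_finite_verts pivots]
  by (simp add: dim_supported pair_finite_verts card_Diff_subset finite_pivots pivots)

text \<open>With no pivots the roots are the unit vectors, and \<open>reduction I u\<close> serves
  as the quotient map.\<close>

lemma is_quotient_reduced_sys: "is_quotient G R (reduced_sys G {} u')"
  unfolding is_quotient_def
proof (intro conjI exI[of _ "reduction I u"])
  show "linear_on (vecs (reduced_sys G {} u')) (scal (reduced_sys G {} u')) (scal R) (reduction I u)"
    by (simp add: linear_on_def reduction_add reduction_scale)
  show "reduction I u ` vecs (reduced_sys G {} u') = vecs R"
    by (simp add: reduction_image)
qed (simp_all add: symplectic_root_system_reduced_sys graph_form_reduction)

end

lemma reduced_family_empty: "pair_graph G \<Longrightarrow> reduced_family G {} u"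
  by (simp add: reduced_family_def reduced_family_axioms_def)

lemma minimal_reduced_sys:
  assumes "pair_graph G"
  shows "minimal G (reduced_sys G {} u)"
proof -
  interpret pair_graph G
    by fact
  have "root (reduced_sys G {} u) = unit_vec"
    by (simp add: fun_eq_iff)
  then show ?thesis
    unfolding minimal_def using inj_unit_vec
    by (auto simp: independent_unit_vecs span_unit_vecs pair_finite_verts intro: inj_on_subset)
qed

section \<open>Classification for kernels of dimension 0, 1 and 2\<close>

lemma classification_trivial:
  fixes G :: "nat pair_pre_digraph"
  assumes G: "pair_graph G" and N: "null_vectors G = {0}" and card: "card (pverts G) = 2 * n"
  shows "\<exists>M. represents_all TYPE('v::ab_group_add) G [M] \<and> has_type M n 0 \<and> minimal G M"
proof -
  define M where "M = reduced_sys G {} (\<lambda>_. 0)"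
  interpret M: reduced_family G "{}" "\<lambda>_. 0"
    using G by (rule reduced_family_empty)
  have null: "null_vectors G \<inter> supported (pverts G - {}) = {0}"
    using N null_vectors_supported[of _ G] by auto
  have "represents_all TYPE('v) G [M]"
  proof (rule represents_allI)
    fix K assume "bvec.subspace K" "K \<subseteq> null_vectors G"
    then have "K = {0}"
      using N bvec.subspace_0 by blast
    then show "K \<in> relations G ` set [M]"
      using M.relations_reduced_sys by (simp add: M_def bvec.span_empty)
  qed (use M.symplectic_root_system_reduced_sys in \<open>auto simp: M_def\<close>)
  moreover have "has_type M n 0"
    unfolding M_def by (rule M.has_type_reduced_sys) (simp_all only: null dim_zero card card.empty)
  moreover have "minimal G M"
    unfolding M_def using G by (rule minimal_reduced_sys)
  ultimately show ?thesis
    by blast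
qed

text \<open>A line has two subspaces: \<open>M\<close> realises 0, and \<open>Q\<close> the line
  itself, with a position where \<open>a\<close> is 1 as pivot.\<close>

lemma classification_line:
  fixes G :: "nat pair_pre_digraph"
  assumes G: "pair_graph G" and N: "null_vectors G = {0, a}" and i: "i \<in> pverts G" "a i = 1"
    and card: "card (pverts G) = 2 * n + 1"
  shows "\<exists>M Q. represents_all TYPE('v::ab_group_add) G [M, Q] \<and>
    has_type M n 1 \<and> minimal G M \<and> has_type Q n 0 \<and> is_quotient G Q M"
proof -
  define M where "M = reduced_sys G {} (\<lambda>_. 0)"
  define Q where "Q = reduced_sys G {i} (\<lambda>_. a)"
  interpret M: reduced_family G "{}" "\<lambda>_. 0"
    using G by (rule reduced_family_empty)
  interpret Q: reduced_family G "{i}" "\<lambda>_. a"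
    using G N i by (simp add: reduced_family_def reduced_family_axioms_def)
  have a: "a \<noteq> 0"
    using i by auto
  have "null_vectors G \<inter> supported (pverts G - {}) = {0, a}"
    using N null_vectors_supported[of _ G] by auto
  then have dim_M: "bvec.dim (null_vectors G \<inter> supported (pverts G - {})) = 1"
    using dim_line[OF a] by simp
  have "null_vectors G \<inter> supported (pverts G - {i}) = {0}"
    using N i null_vectors_supported[of _ G] by (auto simp: supported_def)
  then have dim_Q: "bvec.dim (null_vectors G \<inter> supported (pverts G - {i})) = 0"
    by (simp only: dim_zero)
  have rel: "relations G M = {0}" "relations G Q = {0, a}"
    using M.relations_reduced_sys Q.relations_reduced_sys
    by (simp_all add: M_def Q_def bvec.span_empty span_singleton)
  have "represents_all TYPE('v) G [M, Q]"
  proof (rule represents_allI)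
    fix K assume "bvec.subspace K" "K \<subseteq> null_vectors G"
    then have "K = {0} \<or> K = {0, a}"
      using N bvec.subspace_0 by blast
    then show "K \<in> relations G ` set [M, Q]"
      using rel by auto
  next
    show "distinct (map (relations G) [M, Q])"
      using a by (auto simp: rel)
  qed (use M.symplectic_root_system_reduced_sys Q.symplectic_root_system_reduced_sys in
      \<open>auto simp: M_def Q_def\<close>)
  moreover have "has_type M n 1"
    unfolding M_def by (rule M.has_type_reduced_sys) (simp_all only: dim_M card card.empty)
  moreover have "has_type Q n 0"
    unfolding Q_def by (rule Q.has_type_reduced_sys[OF dim_Q]) (simp add: card)
  moreover have "minimal G M"
    unfolding M_def using G by (rule minimal_reduced_sys)
  moreover have "is_quotient G Q M"
    unfolding M_def Q_def by (rule Q.is_quotient_reduced_sys)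
  ultimately show ?thesis
    by blast
qed

text \<open>Any two of \<open>a\<close>, \<open>b\<close>, \<open>a + b\<close> sum to the third, so
  a subspace contains none of them, one, or all.\<close>

lemma subspaces_of_plane:
  assumes "bvec.subspace K" "K \<subseteq> {0, a, b, a + b}"
  shows "K \<in> {{0}, {0, a}, {0, b}, {0, a + b}, {0, a, b, a + b}}"
proof -
  have "0 \<in> K" "\<And>x y. x \<in> K \<Longrightarrow> y \<in> K \<Longrightarrow> x + y \<in> K"
    using assms(1) by (auto simp: bvec.subspace_def)
  then have "a \<in> K \<Longrightarrow> b \<in> K \<Longrightarrow> a + b \<in> K" "a \<in> K \<Longrightarrow> a + b \<in> K \<Longrightarrow> b \<in> K"
    "b \<in> K \<Longrightarrow> a + b \<in> K \<Longrightarrow> a \<in> K"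
    by (blast, metis bvec_add_add_self, metis bvec_add_self_right)
  with \<open>0 \<in> K\<close> assms(2) show ?thesis
    by (cases "a \<in> K"; cases "b \<in> K"; cases "a + b \<in> K") auto
qed

text \<open>The values at \<open>i\<close> and \<open>j\<close> put \<open>a\<close> and
  \<open>b\<close> in reduced echelon form. The three lines in the plane give the three quotients of
  type (n,1), and the plane itself gives the nondegenerate one.\<close>

lemma classification_plane:
  fixes G :: "nat pair_pre_digraph"
  assumes G: "pair_graph G" and N: "null_vectors G = {0, a, b, a + b}"
    and i: "i \<in> pverts G" "a i = 1" "b i = 0" and j: "j \<in> pverts G" "a j = 0" "b j = 1"
    and card: "card (pverts G) = 2 * n + 2"
  shows "\<exists>M Q1 Q2 Q3 Q. represents_all TYPE('v::ab_group_add) G [M, Q1, Q2, Q3, Q] \<and>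
    has_type M n 2 \<and> minimal G M \<and>
    has_type Q1 n 1 \<and> is_quotient G Q1 M \<and>
    has_type Q2 n 1 \<and> is_quotient G Q2 M \<and>
    has_type Q3 n 1 \<and> is_quotient G Q3 M \<and>
    has_type Q n 0 \<and> is_quotient G Q M"
proof -
  define u where "u = (\<lambda>k. if k = i then a else b)"
  define M where "M = reduced_sys G {} (\<lambda>_. 0)"
  define Q1 where "Q1 = reduced_sys G {i} (\<lambda>_. a)"
  define Q2 where "Q2 = reduced_sys G {j} (\<lambda>_. b)"
  \<comment> \<open>The vector \<open>a + b\<close> is also 1 at \<open>i\<close>, so the same pivot
    serves.\<close>
  define Q3 where "Q3 = reduced_sys G {i} (\<lambda>_. a + b)"
  define Q where "Q = reduced_sys G {i, j} u"
  have ij: "i \<noteq> j"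
    using i j by auto
  interpret M: reduced_family G "{}" "\<lambda>_. 0"
    using G by (rule reduced_family_empty)
  interpret Q1: reduced_family G "{i}" "\<lambda>_. a"
    using G N i by (simp add: reduced_family_def reduced_family_axioms_def)
  interpret Q2: reduced_family G "{j}" "\<lambda>_. b"
    using G N j by (simp add: reduced_family_def reduced_family_axioms_def)
  interpret Q3: reduced_family G "{i}" "\<lambda>_. a + b"
    using G N i by (simp add: reduced_family_def reduced_family_axioms_def)
  interpret Q: reduced_family G "{i, j}" u
    using G N i j ij by (auto simp: reduced_family_def reduced_family_axioms_def u_def)
  have ne: "a \<noteq> 0" "b \<noteq> 0" "a \<noteq> b" "a + b \<noteq> 0" "a + b \<noteq> a" "a + b \<noteq> b"
    using i j by (auto simp: bvec_add_eq_0_iff)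
  have "null_vectors G \<inter> supported (pverts G - {}) = {0, a, b, a + b}"
    using N null_vectors_supported[of _ G] by auto
  then have dim_M: "bvec.dim (null_vectors G \<inter> supported (pverts G - {})) = 2"
    by (simp only: dim_plane ne not_False_eq_True)
  have supp: "v \<in> supported (pverts G)" if "v \<in> {0, a, b, a + b}" for v
    using that N null_vectors_supported[of v G] by auto
  \<comment> \<open>The nullspace of each quotient consists of the kernel vectors that vanish at its
    pivots, which leaves a line for one pivot and 0 for two.\<close>
  have meet: "null_vectors G \<inter> supported (pverts G - J) = {v \<in> {0, a, b, a + b}. \<forall>k\<in>J. v k = 0}" for J
    using supp unfolding N by (auto simp: supported_def)
  have "null_vectors G \<inter> supported (pverts G - {i}) = {0, b}"
    unfolding meet using i by auto
  then have dim_i: "bvec.dim (null_vectors G \<inter> supported (pverts G - {i})) = 1"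
    using dim_line[OF ne(2)] by simp
  have "null_vectors G \<inter> supported (pverts G - {j}) = {0, a}"
    unfolding meet using j by auto
  then have dim_j: "bvec.dim (null_vectors G \<inter> supported (pverts G - {j})) = 1"
    using dim_line[OF ne(1)] by simp
  have "null_vectors G \<inter> supported (pverts G - {i, j}) = {0}"
    unfolding meet using i j by auto
  then have dim_ij: "bvec.dim (null_vectors G \<inter> supported (pverts G - {i, j})) = 0"
    by (simp only: dim_zero)
  have u: "u ` {i, j} = {a, b}"
    using ij by (auto simp: u_def)
  have rel: "relations G M = {0}" "relations G Q1 = {0, a}" "relations G Q2 = {0, b}"
      "relations G Q3 = {0, a + b}" "relations G Q = {0, a, b, a + b}"
    using M.relations_reduced_sys Q1.relations_reduced_sys Q2.relations_reduced_sys
      Q3.relations_reduced_sys Q.relations_reduced_sys[unfolded u]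
    by (simp_all add: M_def Q1_def Q2_def Q3_def Q_def bvec.span_empty span_singleton span_pair)
  have "represents_all TYPE('v) G [M, Q1, Q2, Q3, Q]"
  proof (rule represents_allI)
    fix K assume "bvec.subspace K" "K \<subseteq> null_vectors G"
    then have "K \<in> {{0}, {0, a}, {0, b}, {0, a + b}, {0, a, b, a + b}}"
      unfolding N by (rule subspaces_of_plane)
    then show "K \<in> relations G ` set [M, Q1, Q2, Q3, Q]"
      by (simp add: rel)
  next
    \<comment> \<open>The five subspaces are told apart by which of \<open>a\<close>,
      \<open>b\<close>, \<open>a + b\<close> they contain.\<close>
    have "distinct (map (\<lambda>K. (a \<in> K, b \<in> K, a + b \<in> K)) (map (relations G) [M, Q1, Q2, Q3, Q]))"
      using ne ne(3)[symmetric] by (simp add: rel)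
    then show "distinct (map (relations G) [M, Q1, Q2, Q3, Q])"
      by (simp only: distinct_map)
  qed (use M.symplectic_root_system_reduced_sys Q1.symplectic_root_system_reduced_sys
      Q2.symplectic_root_system_reduced_sys Q3.symplectic_root_system_reduced_sys
      Q.symplectic_root_system_reduced_sys in \<open>auto simp: M_def Q1_def Q2_def Q3_def Q_def\<close>)
  moreover have "has_type M n 2"
    unfolding M_def by (rule M.has_type_reduced_sys[OF dim_M]) (simp add: card)
  moreover have "has_type Q1 n 1"
    unfolding Q1_def by (rule Q1.has_type_reduced_sys[OF dim_i]) (simp add: card)
  moreover have "has_type Q2 n 1"
    unfolding Q2_def by (rule Q2.has_type_reduced_sys[OF dim_j]) (simp add: card)
  moreover have "has_type Q3 n 1"
    unfolding Q3_def by (rule Q3.has_type_reduced_sys[OF dim_i]) (simp add: card)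
  moreover have "has_type Q n 0"
    unfolding Q_def by (rule Q.has_type_reduced_sys[OF dim_ij]) (simp add: card ij)
  moreover have "minimal G M"
    unfolding M_def using G by (rule minimal_reduced_sys)
  moreover have "is_quotient G Q1 M" "is_quotient G Q2 M" "is_quotient G Q3 M" "is_quotient G Q M"
    unfolding M_def Q1_def Q2_def Q3_def Q_def
    by (rule Q1.is_quotient_reduced_sys Q2.is_quotient_reduced_sys
        Q3.is_quotient_reduced_sys Q.is_quotient_reduced_sys)+
  ultimately show ?thesis
    by blast
qed

section \<open>The null vectors of the Dynkin diagrams\<close>

lemma pair_graph_undirected:
  assumes "finite V" "E \<subseteq> V \<times> V" "irrefl E"
  shows "pair_graph (undirected V E)"
proof
  show "finite (parcs (undirected V E))"
    using assms(1) finite_subset[OF assms(2)] by (simp add: undirected_def)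
qed (use assms in \<open>auto simp: undirected_def symmetric_def sym_def irrefl_def
      arcs_ends_def arc_to_ends_def image_iff\<close>)

lemma pair_graph_dynkin_A: "pair_graph (dynkin_A m)"
  unfolding dynkin_A_def by (rule pair_graph_undirected) (auto simp: irrefl_def)

lemma pair_graph_dynkin_D: "m \<ge> 4 \<Longrightarrow> pair_graph (dynkin_D m)"
  unfolding dynkin_D_def by (rule pair_graph_undirected) (auto simp: irrefl_def)

lemma pair_graph_dynkin_E: "m \<ge> 4 \<Longrightarrow> pair_graph (dynkin_E m)"
  unfolding dynkin_E_def by (rule pair_graph_undirected) (auto simp: irrefl_def)

lemma pverts_dynkin [simp]:
  "pverts (dynkin_A m) = {1..m}" "pverts (dynkin_D m) = {1..m}" "pverts (dynkin_E m) = {1..m}"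
  by (simp_all add: dynkin_A_def dynkin_D_def dynkin_E_def undirected_def)

lemma arc_dynkin_A:
  "(k, l) \<in> parcs (dynkin_A m) \<longleftrightarrow> k \<in> {1..m} \<and> l \<in> {1..m} \<and> (l = k + 1 \<or> k = l + 1)"
  by (auto simp: dynkin_A_def undirected_def)

lemma arc_dynkin_D:
  "m \<ge> 4 \<Longrightarrow> (k, l) \<in> parcs (dynkin_D m) \<longleftrightarrow>
    k \<in> {1..m - 1} \<and> l \<in> {1..m - 1} \<and> (l = k + 1 \<or> k = l + 1) \<or>
    k = m - 2 \<and> l = m \<or> k = m \<and> l = m - 2"
  by (auto simp: dynkin_D_def undirected_def)

lemma arc_dynkin_E:
  "(k, l) \<in> parcs (dynkin_E m) \<longleftrightarrow>
    k = 1 \<and> l = 3 \<or> k = 3 \<and> l = 1 \<or> k = 2 \<and> l = 4 \<or> k = 4 \<and> l = 2 \<or>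
    k \<in> {3..m} \<and> l \<in> {3..m} \<and> (l = k + 1 \<or> k = l + 1)"
  by (auto simp: dynkin_E_def undirected_def)

text \<open>The neighbour set may be enlarged by positions where \<open>v\<close> is 0. This treats
  end nodes like inner nodes, since \<open>v\<close> vanishes at 0 and \<open>m + 1\<close>.\<close>

lemma sum_neighbours:
  fixes v :: "'a \<Rightarrow> bit"
  assumes "finite B" "{k. (k, l) \<in> E} \<subseteq> B" "\<And>k. k \<in> B \<Longrightarrow> (k, l) \<notin> E \<Longrightarrow> v k = 0"
  shows "(\<Sum>k | (k, l) \<in> E. v k) = sum v B"
  using assms by (intro sum.mono_neutral_left) auto

lemma null_vectors_dynkin_A:
  "v \<in> null_vectors (dynkin_A m) \<longleftrightarrow>
    v \<in> supported {1..m} \<and> (\<forall>l\<in>{1..m}. v (l - 1) = v (l + 1))"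
proof -
  have "(\<Sum>k | (k, l) \<in> parcs (dynkin_A m). v k) = v (l - 1) + v (l + 1)"
    if "v \<in> supported {1..m}" "l \<in> {1..m}" for l
    using that by (subst sum_neighbours[where B = "{l - 1, l + 1}"])
      (auto simp: arc_dynkin_A supported_def)
  then show ?thesis
    by (auto simp: null_vectors_def)
qed

text \<open>The nodes up to \<open>m - 3\<close> give chain equations, the branch node
  \<open>m - 2\<close> the three-term equation, and both leaves \<open>m - 1\<close> and
  \<open>m\<close> the equation \<open>v (m - 2) = 0\<close>.\<close>

lemma null_vectors_dynkin_D:
  assumes "m \<ge> 4"
  shows "v \<in> null_vectors (dynkin_D m) \<longleftrightarrow>
    v \<in> supported {1..m} \<and> (\<forall>l\<in>{1..m - 3}. v (l - 1) = v (l + 1)) \<and>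
    v (m - 1) = v (m - 3) + v m \<and> v (m - 2) = 0"
proof -
  have 1: "(\<Sum>k | (k, l) \<in> parcs (dynkin_D m). v k) = v (l - 1) + v (l + 1)"
    if "v \<in> supported {1..m}" "l \<in> {1..m - 3}" for l
    using that assms by (subst sum_neighbours[where B = "{l - 1, l + 1}"])
      (auto simp: arc_dynkin_D supported_def)
  have "m - 3 \<noteq> m - 1" "m - 3 \<noteq> m" "m - 1 \<noteq> m"
    using assms by auto
  then have 2: "(\<Sum>k | (k, m - 2) \<in> parcs (dynkin_D m). v k) = v (m - 3) + (v (m - 1) + v m)"
    using assms by (subst sum_neighbours[where B = "{m - 3, m - 1, m}"])
      (auto simp: arc_dynkin_D)
  have 3: "(\<Sum>k | (k, l) \<in> parcs (dynkin_D m). v k) = v (m - 2)" if "l = m - 1 \<or> l = m" for l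
    using that assms by (subst sum_neighbours[where B = "{m - 2}"]) (auto simp: arc_dynkin_D)
  have 4: "{1..m} = {1..m - 3} \<union> {m - 2, m - 1, m}"
    using assms by auto
  have 5: "v (m - 3) + (v (m - 1) + v m) = 0 \<longleftrightarrow> v (m - 1) = v (m - 3) + v m"
    by (cases "v (m - 3)"; cases "v (m - 1)"; cases "v m") auto
  have "(\<forall>l\<in>{1..m}. (\<Sum>k | (k, l) \<in> parcs (dynkin_D m). v k) = 0) \<longleftrightarrow>
      (\<forall>l\<in>{1..m - 3}. v (l - 1) = v (l + 1)) \<and> v (m - 1) = v (m - 3) + v m \<and> v (m - 2) = 0"
    if "v \<in> supported {1..m}"
    unfolding 4 ball_Un using 1[OF that] 2 3 5 by auto
  then show ?thesis
    by (auto simp: null_vectors_def)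
qed

text \<open>The leaves 1 and 2 force \<open>v 3 = 0\<close> and \<open>v 4 = 0\<close>, node 3 then
  forces \<open>v 1 = 0\<close>, the branch node 4 gives \<open>v 2 = v 5\<close>, and the remaining
  arm gives chain equations.\<close>

lemma null_vectors_dynkin_E:
  assumes "m \<ge> 6"
  shows "v \<in> null_vectors (dynkin_E m) \<longleftrightarrow>
    v \<in> supported {1..m} \<and> v 1 = 0 \<and> v 3 = 0 \<and> v 4 = 0 \<and> v 2 = v 5 \<and>
    (\<forall>l\<in>{5..m}. v (l - 1) = v (l + 1))"
proof -
  have 1: "(\<Sum>k | (k, 1) \<in> parcs (dynkin_E m). v k) = v 3"
    using assms by (subst sum_neighbours[where B = "{3}"]) (auto simp: arc_dynkin_E)
  have 2: "(\<Sum>k | (k, 2) \<in> parcs (dynkin_E m). v k) = v 4"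
    using assms by (subst sum_neighbours[where B = "{4}"]) (auto simp: arc_dynkin_E)
  have 3: "(\<Sum>k | (k, 3) \<in> parcs (dynkin_E m). v k) = v 1 + v 4"
    using assms by (subst sum_neighbours[where B = "{1, 4}"]) (auto simp: arc_dynkin_E)
  have 4: "(\<Sum>k | (k, 4) \<in> parcs (dynkin_E m). v k) = v 2 + (v 3 + v 5)"
    using assms by (subst sum_neighbours[where B = "{2, 3, 5}"]) (auto simp: arc_dynkin_E)
  have 5: "(\<Sum>k | (k, l) \<in> parcs (dynkin_E m). v k) = v (l - 1) + v (l + 1)"
    if "v \<in> supported {1..m}" "l \<in> {5..m}" for l
    using that assms by (subst sum_neighbours[where B = "{l - 1, l + 1}"])
      (auto simp: arc_dynkin_E supported_def)
  have 6: "{1..m} = {1, 2, 3, 4} \<union> {5..m}"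
    using assms by auto
  have "(\<forall>l\<in>{1..m}. (\<Sum>k | (k, l) \<in> parcs (dynkin_E m). v k) = 0) \<longleftrightarrow>
      v 1 = 0 \<and> v 3 = 0 \<and> v 4 = 0 \<and> v 2 = v 5 \<and> (\<forall>l\<in>{5..m}. v (l - 1) = v (l + 1))"
    if "v \<in> supported {1..m}"
    unfolding 6 ball_Un using 1 2 3 4 5[OF that] by auto
  then show ?thesis
    by (auto simp: null_vectors_def)
qed

section \<open>Solving the kernel equations\<close>

text \<open>The recurrence moves by two positions: even positions inherit \<open>v 0 = 0\<close>,
  odd positions inherit \<open>v 1\<close>. It reaches one position past the last equation.\<close>

lemma chain_values:
  fixes v :: "nat \<Rightarrow> bit"
  assumes "v 0 = 0" "\<forall>l\<in>{1..r}. v (l - 1) = v (l + 1)" "k \<le> r + 1"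
  shows "v k = of_bool (odd k) * v 1"
  using assms(3)
proof (induction k rule: less_induct)
  case (less k)
  show ?case
  proof (cases "k \<ge> 2")
    case True
    then have "k - 1 \<in> {1..r}"
      using less.prems by auto
    then have "v (k - 1 - 1) = v (k - 1 + 1)"
      using assms(2) by blast
    then have "v (k - 2) = v k"
      using True by (simp add: numeral_2_eq_2)
    then show ?thesis
      using less.IH[of "k - 2"] less.prems True by simp
  next
    case False
    then have "k = 0 \<or> k = 1"
      by auto
    then show ?thesis
      using assms(1) by auto
  qed
qed

lemma bscale_in_line: "v = bscale c a \<Longrightarrow> v \<in> {0, a}"
  using bscale_cases by blast

text \<open>Position \<open>m + 1\<close> is odd and lies off the diagram, so
  \<open>v 1 = v (m + 1) = 0\<close>.\<close>

lemma null_vectors_A_even: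
  assumes "even m"
  shows "null_vectors (dynkin_A m) = {0}"
proof -
  have "v = 0" if "v \<in> null_vectors (dynkin_A m)" for v
  proof
    fix k :: nat
    have v: "v 0 = 0" "\<forall>l\<in>{1..m}. v (l - 1) = v (l + 1)" "v (m + 1) = 0" "\<And>k. k > m \<Longrightarrow> v k = 0"
      using that by (auto simp: null_vectors_dynkin_A supported_def)
    have "v 1 = 0"
      using chain_values[OF v(1,2), of "m + 1"] v(3) assms by simp
    then show "v k = 0 k"
      using chain_values[OF v(1,2), of k] v(4)[of k] by (cases "k \<le> m + 1") auto
  qed
  moreover have "0 \<in> null_vectors (dynkin_A m)"
    by (rule bvec.subspace_0[OF subspace_null_vectors])
  ultimately show ?thesis
    by blast
qed

text \<open>Position \<open>m + 1\<close> is even, so the end of the chain imposes nothing further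
  and \<open>v 1\<close> is free.\<close>

lemma null_vectors_A_odd:
  assumes "odd m"
  shows "null_vectors (dynkin_A m) = {0, \<lambda>k. of_bool (odd k \<and> k \<le> m)}" (is "_ = {0, ?a}")
proof -
  have "v \<in> {0, ?a}" if "v \<in> null_vectors (dynkin_A m)" for v
  proof (rule bscale_in_line, rule ext)
    fix k :: nat
    have v: "v 0 = 0" "\<forall>l\<in>{1..m}. v (l - 1) = v (l + 1)" "\<And>k. k > m \<Longrightarrow> v k = 0"
      using that by (auto simp: null_vectors_dynkin_A supported_def)
    show "v k = bscale (v 1) ?a k"
      using chain_values[OF v(1,2), of k] v(3)[of k] by (cases "k \<le> m") auto
  qed
  moreover have "?a \<in> null_vectors (dynkin_A m)"
  proof -
    \<comment> \<open>The cut-off at \<open>m\<close> matters only for \<open>l = m\<close>, where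
      \<open>l - 1\<close> and \<open>l + 1\<close> are both even.\<close>
    have "?a (l - 1) = ?a (l + 1)" if "l \<in> {1..m}" for l
      using that assms by (cases "l = m") auto
    then show ?thesis
      by (auto simp: null_vectors_dynkin_A supported_def Suc_le_eq)
  qed
  ultimately show ?thesis
    using bvec.subspace_0[OF subspace_null_vectors[of "dynkin_A m"]] by blast
qed

text \<open>As \<open>m - 2\<close> is odd, \<open>v (m - 2) = 0\<close> forces
  \<open>v 1 = 0\<close>, so the chain vanishes and only the common value at the two leaves
  \<open>m - 1\<close> and \<open>m\<close> is free.\<close>

lemma null_vectors_D_odd:
  assumes "m \<ge> 4" "odd m"
  shows "null_vectors (dynkin_D m) = {0, \<lambda>k. of_bool (k = m - 1 \<or> k = m)}" (is "_ = {0, ?a}")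
proof -
  have "v \<in> {0, ?a}" if "v \<in> null_vectors (dynkin_D m)" for v
  proof (rule bscale_in_line, rule ext)
    fix k :: nat
    have v: "v 0 = 0" "\<forall>l\<in>{1..m - 3}. v (l - 1) = v (l + 1)" "\<And>k. k > m \<Longrightarrow> v k = 0"
      "v (m - 1) = v (m - 3) + v m" "v (m - 2) = 0"
      using that assms by (auto simp: null_vectors_dynkin_D supported_def)
    have "v 1 = 0"
      using chain_values[OF v(1,2), of "m - 2"] v(5) assms by simp
    then have low: "v k = 0" if "k \<le> m - 2" for k
      using chain_values[OF v(1,2), of k] that assms by simp
    have "k \<le> m - 2 \<or> k = m - 1 \<or> k = m \<or> k > m"
      by linarith
    then show "v k = bscale (v m) ?a k"
      using low[of k] low[of "m - 3"] v(3)[of k] v(4) assms by auto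
  qed
  moreover have "?a \<in> null_vectors (dynkin_D m)"
    using assms by (auto simp: null_vectors_dynkin_D supported_def)
  ultimately show ?thesis
    using bvec.subspace_0[OF subspace_null_vectors[of "dynkin_D m"]] by blast
qed

text \<open>As \<open>m - 2\<close> is even, \<open>v (m - 2) = 0\<close> holds automatically, so
  \<open>v 1\<close> and \<open>v m\<close> are both free and determine
  \<open>v (m - 1)\<close>.\<close>

lemma null_vectors_D_even:
  assumes "m \<ge> 4" "even m"
  shows "null_vectors (dynkin_D m) =
    {0, \<lambda>k. of_bool (k = m - 1 \<or> k = m), \<lambda>k. of_bool (odd k \<and> k \<le> m),
     (\<lambda>k. of_bool (k = m - 1 \<or> k = m)) + (\<lambda>k. of_bool (odd k \<and> k \<le> m))}"
    (is "_ = {0, ?a, ?b, ?a + ?b}")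
proof -
  have "v \<in> {0, ?a, ?b, ?a + ?b}" if "v \<in> null_vectors (dynkin_D m)" for v
  proof -
    have v: "v 0 = 0" "\<forall>l\<in>{1..m - 3}. v (l - 1) = v (l + 1)" "\<And>k. k > m \<Longrightarrow> v k = 0"
      "v (m - 1) = v (m - 3) + v m" "v (m - 2) = 0"
      using that assms by (auto simp: null_vectors_dynkin_D supported_def)
    have low: "v k = of_bool (odd k) * v 1" if "k \<le> m - 2" for k
      using chain_values[OF v(1,2), of k] that assms by simp
    \<comment> \<open>The coefficients are read off at \<open>m\<close>, where only the first basis
      vector is 1, and at 1, where only the second is.\<close>
    have "v = bscale (v m) ?a + bscale (v 1) ?b"
    proof
      fix k :: nat
      have "k \<le> m - 2 \<or> k = m - 1 \<or> k = m \<or> k > m"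
        by linarith
      then show "v k = (bscale (v m) ?a + bscale (v 1) ?b) k"
        using low[of k] low[of "m - 3"] v(3)[of k] v(4) assms by (auto simp: add.commute)
    qed
    then show ?thesis
      using bscale_cases[of "v m" ?a] bscale_cases[of "v 1" ?b] by auto
  qed
  moreover have "?a \<in> null_vectors (dynkin_D m)"
    using assms by (auto simp: null_vectors_dynkin_D supported_def)
  moreover have "?b \<in> null_vectors (dynkin_D m)"
    using assms by (auto simp: null_vectors_dynkin_D supported_def Suc_le_eq)
  ultimately show ?thesis
    using bvec.subspace_0[OF subspace_null_vectors[of "dynkin_D m"]]
      bvec.subspace_add[OF subspace_null_vectors[of "dynkin_D m"], of ?a ?b] by blast
qed

text \<open>On the long arm the odd positions share the value \<open>v 5\<close>; as
  \<open>m + 1\<close> is odd and off the diagram, this value is 0, and so is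
  \<open>v 2\<close>.\<close>

lemma null_vectors_E6_E8:
  assumes "m = 6 \<or> m = 8"
  shows "null_vectors (dynkin_E m) = {0}"
proof -
  have "v = 0" if "v \<in> null_vectors (dynkin_E m)" for v
  proof
    fix k :: nat
    have v: "\<And>k. k = 0 \<or> k > m \<Longrightarrow> v k = 0" "v 1 = 0" "v 3 = 0" "v 4 = 0" "v 2 = v 5"
      "\<And>l. 5 \<le> l \<Longrightarrow> l \<le> m \<Longrightarrow> v (l - 1) = v (l + 1)"
      using that assms by (auto simp: null_vectors_dynkin_E supported_def)
    have "k = 0 \<or> k = 1 \<or> k = 2 \<or> k = 3 \<or> k = 4 \<or> k = 5 \<or> k = 6 \<or> k = 7 \<or> k = 8 \<or> k > 8"
      by linarith
    then show "v k = 0 k"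
      using assms v(1)[of k] v(1)[of "m + 1"] v(2-5) v(6)[of 5] v(6)[of 6] v(6)[of 7] v(6)[of 8]
      by auto
  qed
  then show ?thesis
    using bvec.subspace_0[OF subspace_null_vectors[of "dynkin_E m"]] by blast
qed

text \<open>Position 8 is even, so the end of the arm only repeats \<open>v 4 = v 6 = 0\<close>, and
  the common value at 2, 5 and 7 stays free.\<close>

lemma null_vectors_E7: "null_vectors (dynkin_E 7) = {0, \<lambda>k. of_bool (k \<in> {2, 5, 7})}"
    (is "_ = {0, ?a}")
proof -
  have "v \<in> {0, ?a}" if "v \<in> null_vectors (dynkin_E 7)" for v
  proof (rule bscale_in_line, rule ext)
    fix k :: nat
    have v: "\<And>k. k = 0 \<or> k > 7 \<Longrightarrow> v k = 0" "v 1 = 0" "v 3 = 0" "v 4 = 0" "v 2 = v 5"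
      "\<And>l. 5 \<le> l \<Longrightarrow> l \<le> 7 \<Longrightarrow> v (l - 1) = v (l + 1)"
      using that by (auto simp: null_vectors_dynkin_E supported_def)
    have "k = 0 \<or> k = 1 \<or> k = 2 \<or> k = 3 \<or> k = 4 \<or> k = 5 \<or> k = 6 \<or> k = 7 \<or> k > 7"
      by linarith
    then show "v k = bscale (v 7) ?a k"
      using v(1)[of k] v(2-5) v(6)[of 5] v(6)[of 6] v(6)[of 7] by auto
  qed
  moreover have "?a (l - 1) = ?a (l + 1)" if "l \<in> {5..7}" for l
  proof -
    have "l = 5 \<or> l = 6 \<or> l = 7"
      using that by auto
    then show ?thesis
      by auto
  qed
  then have "?a \<in> null_vectors (dynkin_E 7)"
    by (auto simp: null_vectors_dynkin_E supported_def)
  ultimately show ?thesis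
    using bvec.subspace_0[OF subspace_null_vectors[of "dynkin_E 7"]] by blast
qed

text \<open>Each diagram is settled by the dimension of its kernel. The bounds on \<open>n\<close>
  express that \<open>A\<close> has at least one node and \<open>D\<close> at least four.\<close>

theorem theorem6p1:
  fixes n :: nat
  shows
    "(n \<ge> 1 \<longrightarrow>
      (\<exists>M. represents_all TYPE('v::ab_group_add) (dynkin_A (2 * n)) [M] \<and>
        has_type M n 0 \<and> minimal (dynkin_A (2 * n)) M)) \<and>
    (\<exists>M Q. represents_all TYPE('v) (dynkin_A (2 * n + 1)) [M, Q] \<and>
        has_type M n 1 \<and> minimal (dynkin_A (2 * n + 1)) M \<and>
        has_type Q n 0 \<and> is_quotient (dynkin_A (2 * n + 1)) Q M) \<and>
    (n \<ge> 2 \<longrightarrow>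
      (\<exists>M Q. represents_all TYPE('v) (dynkin_D (2 * n + 1)) [M, Q] \<and>
        has_type M n 1 \<and> minimal (dynkin_D (2 * n + 1)) M \<and>
        has_type Q n 0 \<and> is_quotient (dynkin_D (2 * n + 1)) Q M)) \<and>
    (n \<ge> 1 \<longrightarrow>
      (\<exists>M Q1 Q2 Q3 Q. represents_all TYPE('v) (dynkin_D (2 * n + 2)) [M, Q1, Q2, Q3, Q] \<and>
        has_type M n 2 \<and> minimal (dynkin_D (2 * n + 2)) M \<and>
        has_type Q1 n 1 \<and> is_quotient (dynkin_D (2 * n + 2)) Q1 M \<and>
        has_type Q2 n 1 \<and> is_quotient (dynkin_D (2 * n + 2)) Q2 M \<and>
        has_type Q3 n 1 \<and> is_quotient (dynkin_D (2 * n + 2)) Q3 M \<and>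
        has_type Q n 0 \<and> is_quotient (dynkin_D (2 * n + 2)) Q M)) \<and>
    (\<exists>M. represents_all TYPE('v) (dynkin_E 6) [M] \<and>
        has_type M 3 0 \<and> minimal (dynkin_E 6) M) \<and>
    (\<exists>M Q. represents_all TYPE('v) (dynkin_E 7) [M, Q] \<and>
        has_type M 3 1 \<and> minimal (dynkin_E 7) M \<and>
        has_type Q 3 0 \<and> is_quotient (dynkin_E 7) Q M) \<and>
    (\<exists>M. represents_all TYPE('v) (dynkin_E 8) [M] \<and>
        has_type M 4 0 \<and> minimal (dynkin_E 8) M)"
proof (intro conjI impI)
  assume "n \<ge> 1"
  show "\<exists>M. represents_all TYPE('v) (dynkin_A (2 * n)) [M] \<and>
      has_type M n 0 \<and> minimal (dynkin_A (2 * n)) M"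
    by (rule classification_trivial[OF pair_graph_dynkin_A null_vectors_A_even]) simp_all
next
  show "\<exists>M Q. represents_all TYPE('v) (dynkin_A (2 * n + 1)) [M, Q] \<and>
      has_type M n 1 \<and> minimal (dynkin_A (2 * n + 1)) M \<and>
      has_type Q n 0 \<and> is_quotient (dynkin_A (2 * n + 1)) Q M"
    by (rule classification_line[OF pair_graph_dynkin_A null_vectors_A_odd, where i = 1]) simp_all
next
  \<comment> \<open>The last node is a leaf at which the null vector is 1, hence a pivot.\<close>
  assume "n \<ge> 2"
  then show "\<exists>M Q. represents_all TYPE('v) (dynkin_D (2 * n + 1)) [M, Q] \<and>
      has_type M n 1 \<and> minimal (dynkin_D (2 * n + 1)) M \<and>
      has_type Q n 0 \<and> is_quotient (dynkin_D (2 * n + 1)) Q M"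
    by (intro classification_line[OF pair_graph_dynkin_D null_vectors_D_odd, where i = "2 * n + 1"])
      simp_all
next
  \<comment> \<open>The pivots are the last node, where only the leaf vector is 1, and node 1, where
    only the alternating vector is 1.\<close>
  assume "n \<ge> 1"
  then show "\<exists>M Q1 Q2 Q3 Q. represents_all TYPE('v) (dynkin_D (2 * n + 2)) [M, Q1, Q2, Q3, Q] \<and>
      has_type M n 2 \<and> minimal (dynkin_D (2 * n + 2)) M \<and>
      has_type Q1 n 1 \<and> is_quotient (dynkin_D (2 * n + 2)) Q1 M \<and>
      has_type Q2 n 1 \<and> is_quotient (dynkin_D (2 * n + 2)) Q2 M \<and>
      has_type Q3 n 1 \<and> is_quotient (dynkin_D (2 * n + 2)) Q3 M \<and>
      has_type Q n 0 \<and> is_quotient (dynkin_D (2 * n + 2)) Q M"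
    by (intro classification_plane[OF pair_graph_dynkin_D null_vectors_D_even,
          where i = "2 * n + 2" and j = 1]) simp_all
next
  show "\<exists>M. represents_all TYPE('v) (dynkin_E 6) [M] \<and>
      has_type M 3 0 \<and> minimal (dynkin_E 6) M"
    by (rule classification_trivial[OF pair_graph_dynkin_E null_vectors_E6_E8]) simp_all
next
  show "\<exists>M Q. represents_all TYPE('v) (dynkin_E 7) [M, Q] \<and>
      has_type M 3 1 \<and> minimal (dynkin_E 7) M \<and>
      has_type Q 3 0 \<and> is_quotient (dynkin_E 7) Q M"
    by (rule classification_line[OF pair_graph_dynkin_E null_vectors_E7, where i = 7]) simp_all
next
  show "\<exists>M. represents_all TYPE('v) (dynkin_E 8) [M] \<and>
      has_type M 4 0 \<and> minimal (dynkin_E 8) M"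
    by (rule classification_trivial[OF pair_graph_dynkin_E null_vectors_E6_E8]) simp_all
qed

end
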